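(* For all positive integers $m,n$ with $n\ge m$, \[ 0\le m-P^-_{m,n}\le 3m^{3/4}. \] In particular, \[ \lim_{m\to\infty}\ \sup_{n\ge m}\left|\frac{P^-_{m,n}}{m}-1\right|=0 . \]
   Context: Card guessing with yes/no (partial) feedback. Fix positive integers $m,n$; let $[n]=\{1,\dots,n\}$ and let $\Omega_{m,n}$ be the set of words of length $mn$ over $[n]$ in which each label occurs exactly $m$ times. The card sequence $X=(X_1,\dots,X_{mn})$ is uniform on $\Omega_{m,n}$. In round $t=1,\dots,mn$ the player first guesses $G_t\in[n]$ and then receives only the feedback $Y_t=\mathbf 1\{G_t=X_t\}$. A strategy $A$ is a rule in which each guess $G_t$ may depend on all previous guesses and feedback and on a random seed independent of the card sequence (no restrictions on memory or computation). A deterministic strategy is a family of functions $A_t:\{0,1\}^{t-1}\to[n]$, with $G_t=A_t(Y_1,\dots,Y_{t-1})$. The score is $S=\sum_{t=1}^{mn}Y_t$, and $P^-_{m,n}=\inf_A\mathbb E_A S$, where the infimum is over all strategies $A$ and $\mathbb E_A S$ is the expected score under $A$. *)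

theory Defs
  imports "HOL-Probability.Probability"
begin

definition card_words :: "nat \<Rightarrow> nat \<Rightarrow> nat list set" where
  "card_words m n =
     {w. length w = m * n \<and> set w \<subseteq> {1..n} \<and> (\<forall>i\<in>{1..n}. count_list w i = m)}"

text \<open>A history is the chronological list of past pairs (guess, feedback). A rule maps a history
  of length \<open>t\<close> to the guess in round \<open>t + 1\<close>, where the card is \<open>w ! t\<close>.\<close>

type_synonym history = "(nat \<times> bool) list"

primrec play :: "(history \<Rightarrow> nat) \<Rightarrow> nat list \<Rightarrow> nat \<Rightarrow> history" where
  "play g w 0 = []"
| "play g w (Suc t) = (let h = play g w t in h @ [(g h, g h = w ! t)])"

definition score :: "(history \<Rightarrow> nat) \<Rightarrow> nat list \<Rightarrow> nat" where
  "score g w = (\<Sum>t<length w. of_bool (g (play g w t) = w ! t))"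

text \<open>A strategy is an arbitrary probability space \<open>M\<close> of seeds together with a guessing rule for
  each seed. Membership in \<open>M \<rightarrow>\<^sub>M count_space {1..n}\<close> says both that the guess
  is a label in \<open>{1..n}\<close> and that it is a random variable. The rule is total; its values
  after the last round \<open>m * n\<close> do not affect the score of a word of length \<open>m * n\<close>.\<close>

definition strategies :: "'s itself \<Rightarrow> nat \<Rightarrow> ('s measure \<times> ('s \<Rightarrow> history \<Rightarrow> nat)) set" where
  "strategies _ n =
     {(M, A). prob_space M \<and>
        (\<forall>h. (\<lambda>s. A s h) \<in> M \<rightarrow>\<^sub>M count_space {1..n})}"

text \<open>Taking the product measure makes the seed independent of the uniform card sequence.\<close>

definition expected_score :: "nat \<Rightarrow> nat \<Rightarrow> 's measure \<Rightarrow> ('s \<Rightarrow> history \<Rightarrow> nat) \<Rightarrow> real" where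
  "expected_score m n M A =
     (\<integral>(s, w). real (score (A s) w) \<partial>(M \<Otimes>\<^sub>M measure_pmf (pmf_of_set (card_words m n))))"

text \<open>HOL cannot quantify over all seed types inside a term, so the type is a parameter; a theorem
  about \<open>P_minus TYPE('s)\<close> with \<open>'s\<close> free covers seeds of every type.\<close>

definition P_minus :: "'s itself \<Rightarrow> nat \<Rightarrow> nat \<Rightarrow> real" where
  "P_minus T m n = (INF (M, A)\<in>strategies T n. expected_score m n M A)"

end

theory Submission imports Defs begin

text \<open>Guessing one label forever scores exactly \<open>m\<close>, so the work is the lower bound, and by Fubini
  it suffices to prove it for a deterministic rule. Write \<open>N = m n\<close>, let \<open>p\<^sub>t\<close> be the probability
  of a hit in round \<open>t\<close> given the history, and let \<open>a\<close> and \<open>b\<close> be the numbers of earlier guesses and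
  earlier hits of the label \<open>i\<close> guessed in round \<open>t\<close>.

  Naively the \<open>m - b\<close> missing copies of \<open>i\<close> are spread over the \<open>N - a\<close> positions at which \<open>i\<close> was
  not tried, so that \<open>p\<^sub>t \<ge> (m - b) / (N - a)\<close>. The history can contradict this: wrong guesses of
  other labels may be known to push them into the future. But exchanging the cards of round \<open>t\<close> and
  of a past round \<open>s\<close> with a wrong guess of some \<open>j \<noteq> i\<close> leaves the history unchanged unless the card
  of round \<open>t\<close> is \<open>j\<close>. Hence the naive bound is true up to the conditional expectation \<open>\<epsilon>\<^sub>t\<close> of the
  number of past rounds \<open>s\<close> whose card is the label guessed at \<open>t\<close> while the card at \<open>t\<close> is the label
  guessed at \<open>s\<close> (\<open>hit_prob_lower_bound\<close>). Since the unseen cards are exchangeable, \<open>\<epsilon>\<^sub>t\<close> has mean at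
  most \<open>m\<^sup>2 / (N - t)\<close> (\<open>sum_crossing_avg\<close>).

  For each label, the hits minus the probabilities \<open>p\<close> at the rounds guessing that label form a
  martingale, and the squares of these \<open>n\<close> martingales have total mean at most the mean score. One may
  assume that the mean score is at most \<open>m\<close>; then the martingale of the label guessed at \<open>t\<close>, however
  that label is selected, has mean absolute value at most \<open>sqrt m\<close> (\<open>sum_excess_squared\<close>). So \<open>b\<close> may
  be replaced by the sum \<open>P\<close> of the probabilities spent on \<open>i\<close>, and the lower bound becomes
  \<open>p\<^sub>t \<ge> (m - P - error) / (N - a)\<close>. Along each path the solution of this recurrence without error
  is \<open>P = a / n\<close>, and deviations from it are damped, so the errors just add up (\<open>sum_rates_ge\<close>).

  Up to a round \<open>T\<close> the sum of the hit probabilities therefore has mean at least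
  \<open>T / n - T / (N - T) * (sqrt m + m\<^sup>2 / (N - T))\<close>. Taking \<open>N - T\<close> close to \<open>N / m powr (1/4)\<close>
  loses about \<open>m powr (3/4)\<close> from the rounds after \<open>T\<close>, as much from the martingales, and at most
  \<open>sqrt m\<close> from the crossings; the last step is where \<open>m \<le> n\<close> is used.\<close>

section \<open>Averages over the fibres of a function\<close>

text \<open>This is the conditional expectation given \<open>f\<close> for the uniform distribution on a finite
  set \<open>A\<close>; the following lemma is its defining property.\<close>

definition fibre_avg :: "'a set \<Rightarrow> ('a \<Rightarrow> 'b) \<Rightarrow> ('a \<Rightarrow> real) \<Rightarrow> 'a \<Rightarrow> real" where
  "fibre_avg A f x w = (\<Sum>v\<in>{v \<in> A. f v = f w}. x v) / card {v \<in> A. f v = f w}"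

lemma sum_mult_fibre_avg:
  assumes A: "finite A"
    and k: "\<And>v w. v \<in> A \<Longrightarrow> w \<in> A \<Longrightarrow> f v = f w \<Longrightarrow> k v = k w"
  shows "(\<Sum>w\<in>A. k w * fibre_avg A f x w) = (\<Sum>w\<in>A. k w * x w)"
proof -
  let ?c = "\<lambda>w. card {v \<in> A. f v = f w}"
  have "(\<Sum>w\<in>A. k w * fibre_avg A f x w)
      = (\<Sum>w\<in>A. \<Sum>v\<in>{v \<in> A. f v = f w}. k w * x v / ?c w)"
    by (simp add: fibre_avg_def sum_divide_distrib sum_distrib_left)
  also have "\<dots> = (\<Sum>v\<in>A. \<Sum>w\<in>{w \<in> A. f v = f w}. k w * x v / ?c w)"
    by (rule sum.swap_restrict[OF A A])
  also have "\<dots> = (\<Sum>v\<in>A. \<Sum>w\<in>{w \<in> A. f w = f v}. k v * x v / ?c v)"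
  proof (intro sum.cong refl)
    fix v w assume "v \<in> A" "w \<in> {w \<in> A. f w = f v}"
    then show "k w * x v / ?c w = k v * x v / ?c v" using k[of w v] by simp
  qed auto
  also have "\<dots> = (\<Sum>v\<in>A. k v * x v)"
  proof (rule sum.cong[OF refl])
    fix v assume "v \<in> A"
    then have "?c v \<noteq> 0" using A by auto
    then show "(\<Sum>w\<in>{w \<in> A. f w = f v}. k v * x v / ?c v) = k v * x v" by simp
  qed
  finally show ?thesis .
qed

lemma sum_fibre_avg:
  "finite A \<Longrightarrow> (\<Sum>w\<in>A. fibre_avg A f x w) = (\<Sum>w\<in>A. x w)"
  using sum_mult_fibre_avg[of A f "\<lambda>_. 1" x] by simp

lemma fibre_avg_cong: "f v = f w \<Longrightarrow> fibre_avg A f x v = fibre_avg A f x w"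
  by (simp add: fibre_avg_def)

lemma fibre_avg_nonneg: "(\<And>v. v \<in> A \<Longrightarrow> 0 \<le> x v) \<Longrightarrow> 0 \<le> fibre_avg A f x w"
  unfolding fibre_avg_def by (intro divide_nonneg_nonneg sum_nonneg) auto

section \<open>One path of guesses\<close>

definition label_sum :: "(nat \<Rightarrow> nat) \<Rightarrow> (nat \<Rightarrow> real) \<Rightarrow> nat \<Rightarrow> nat \<Rightarrow> real" where
  "label_sum G x i t = (\<Sum>s<t. if G s = i then x s else 0)"

lemma label_sum_0 [simp]: "label_sum G x i 0 = 0"
  by (simp add: label_sum_def)

lemma label_sum_Suc:
  "label_sum G x i (Suc t) = label_sum G x i t + (if G t = i then x t else 0)"
  by (simp add: label_sum_def)

lemma label_sum_cong:
  "(\<And>s. s < t \<Longrightarrow> G s = G' s) \<Longrightarrow> (\<And>s. s < t \<Longrightarrow> x s = x' s) \<Longrightarrow>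
    label_sum G x i t = label_sum G' x' i t"
  unfolding label_sum_def by (intro sum.cong) auto

lemma label_sum_diff:
  "label_sum G (\<lambda>s. x s - y s) i t = label_sum G x i t - label_sum G y i t"
  by (induction t) (auto simp: label_sum_Suc)

lemma label_sum_const: "label_sum G (\<lambda>_. c) i t = c * label_sum G (\<lambda>_. 1) i t"
  by (induction t) (auto simp: label_sum_Suc algebra_simps)

lemma label_sum_nonneg: "(\<And>s. s < t \<Longrightarrow> 0 \<le> x s) \<Longrightarrow> 0 \<le> label_sum G x i t"
  unfolding label_sum_def by (intro sum_nonneg) auto

lemma label_sum_one_le: "label_sum G (\<lambda>_. 1) i t \<le> t"
  by (induction t) (auto simp: label_sum_Suc)

lemma sum_label_sum:
  assumes "finite I" "\<And>s. s < t \<Longrightarrow> G s \<in> I"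
  shows "(\<Sum>i\<in>I. label_sum G x i t) = (\<Sum>s<t. x s)"
proof -
  have "(\<Sum>i\<in>I. label_sum G x i t) = (\<Sum>s<t. \<Sum>i\<in>I. if G s = i then x s else 0)"
    unfolding label_sum_def by (rule sum.swap)
  also have "\<dots> = (\<Sum>s<t. x s)" using assms by (intro sum.cong) auto
  finally show ?thesis .
qed

text \<open>For a label with \<open>a\<close> earlier guesses, let \<open>u\<close> be the sum of \<open>p - 1 / n\<close> over them. The
  hypothesis at the next guess reads \<open>p - 1 / n \<ge> - (u + M + \<epsilon>) / (N - a)\<close> with \<open>M\<close> the hits
  in excess of the rates. The term \<open>- u / (N - a)\<close> pulls \<open>u\<close> towards \<open>0\<close>, so \<open>u\<close> never
  falls below minus the sum of the errors \<open>(\<bar>M\<bar> + \<epsilon>) / (N - a)\<close> met so far;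
  finally \<open>a \<le> t\<close>.\<close>

lemma sum_rates_ge:
  fixes G :: "nat \<Rightarrow> nat" and Y p \<epsilon> :: "nat \<Rightarrow> real" and m n N T :: nat
  assumes n: "0 < n" and N: "N = m * n" and T: "T \<le> N"
    and G: "\<And>t. t < T \<Longrightarrow> G t \<in> {1..n}"
    and eps: "\<And>t. t < T \<Longrightarrow> 0 \<le> \<epsilon> t"
    and rate: "\<And>t. t < T \<Longrightarrow>
      m - label_sum G Y (G t) t - \<epsilon> t \<le> (N - label_sum G (\<lambda>_. 1) (G t) t) * p t"
  shows "T / n - (\<Sum>t<T. (\<bar>label_sum G (\<lambda>s. Y s - p s) (G t) t\<bar> + \<epsilon> t) / (N - t))
    \<le> (\<Sum>t<T. p t)"
proof -
  define M where "M = label_sum G (\<lambda>s. Y s - p s)"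
  define a where "a = label_sum G (\<lambda>_. 1)"
  define e where "e = (\<lambda>t. (\<bar>M (G t) t\<bar> + \<epsilon> t) / (N - t))"
  have e0: "0 \<le> e t" if "t < T" for t
    using eps[OF that] that T by (auto simp: e_def intro!: divide_nonneg_nonneg)
  have lower: "- label_sum G e i t \<le> label_sum G (\<lambda>s. p s - 1 / n) i t" if "t \<le> T" for i t
    using that
  proof (induction t)
    case (Suc t)
    then have t: "t < T" by simp
    let ?u = "label_sum G (\<lambda>s. p s - 1 / n)"
    show ?case
    proof (cases "G t = i")
      case True
      define k where "k = N - a i t"
      have at: "a i t \<le> t" by (simp add: a_def label_sum_one_le)
      have k: "1 \<le> k" "real N - t \<le> k" using at t T by (auto simp: k_def)
      have u: "?u i t = label_sum G Y i t - M i t - a i t / n"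
        using label_sum_const[of G "1 / n" i t] by (simp add: M_def a_def label_sum_diff)
      have "m - label_sum G Y i t - \<epsilon> t \<le> k * p t"
        using rate[OF t] True by (simp add: k_def a_def)
      then have "k / n - (?u i t + M i t + \<epsilon> t) \<le> k * p t"
        using n by (simp add: u k_def N diff_divide_distrib)
      then have "k * (p t - 1 / n) \<ge> - (?u i t + M i t + \<epsilon> t)" by (simp add: algebra_simps)
      then have step: "p t - 1 / n \<ge> - (?u i t + M i t + \<epsilon> t) / k"
        using k(1) by (simp add: field_simps)
      have "(M i t + \<epsilon> t) / k \<le> (\<bar>M i t\<bar> + \<epsilon> t) / (N - t)"
        using k t T eps[OF t] by (intro frac_le) auto
      then have e: "(M i t + \<epsilon> t) / k \<le> e t" using True t T by (simp add: e_def of_nat_diff)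
      have Q: "0 \<le> label_sum G e i t" using e0 t by (intro label_sum_nonneg) auto
      \<comment> \<open>The factor \<open>1 - 1 / k\<close> lies in \<open>[0, 1)\<close>, so it can only shrink an inherited deficit.\<close>
      have "- label_sum G e i t \<le> - label_sum G e i t * (1 - 1 / k)"
        using Q k(1) by (simp add: algebra_simps)
      also have "\<dots> \<le> ?u i t * (1 - 1 / k)"
        using Suc k(1) by (intro mult_right_mono) auto
      finally have "- label_sum G e i t - e t \<le> ?u i t * (1 - 1 / k) - (M i t + \<epsilon> t) / k"
        using e by simp
      also have "\<dots> = ?u i t + - (?u i t + M i t + \<epsilon> t) / k"
        using k(1) by (simp add: field_simps)
      finally show ?thesis using step True by (simp add: label_sum_Suc)
    qed (use Suc in \<open>auto simp: label_sum_Suc\<close>)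
  qed simp
  have "- (\<Sum>t<T. e t) = (\<Sum>i\<in>{1..n}. - label_sum G e i T)"
    using G by (subst sum_negf) (simp add: sum_label_sum)
  also have "\<dots> \<le> (\<Sum>i\<in>{1..n}. label_sum G (\<lambda>s. p s - 1 / n) i T)"
    by (intro sum_mono lower) simp
  also have "\<dots> = (\<Sum>t<T. p t - 1 / n)" using G by (intro sum_label_sum) auto
  also have "\<dots> = (\<Sum>t<T. p t) - T / n" by (simp add: sum_subtractf)
  finally show ?thesis by (simp add: e_def M_def)
qed

section \<open>Words, swaps and histories\<close>

definition swap :: "nat \<Rightarrow> nat \<Rightarrow> 'a list \<Rightarrow> 'a list" where
  "swap s t w = w[s := w ! t, t := w ! s]"

lemma length_swap [simp]: "length (swap s t w) = length w"
  by (simp add: swap_def)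

lemma nth_swap:
  "s < length w \<Longrightarrow> t < length w \<Longrightarrow>
    swap s t w ! u = (if u = t then w ! s else if u = s then w ! t else w ! u)"
  by (auto simp: swap_def nth_list_update)

lemma swap_swap: "s < length w \<Longrightarrow> t < length w \<Longrightarrow> swap s t (swap s t w) = w"
  by (rule nth_equalityI) (auto simp: nth_swap)

lemma mset_of_swap: "s < length w \<Longrightarrow> t < length w \<Longrightarrow> mset (swap s t w) = mset w"
  unfolding swap_def by (metis mset_swap)

lemma count_list_eq_card: "count_list w i = card {u. u < length w \<and> w ! u = i}"
  by (simp add: count_list_eq_length_filter length_filter_conv_card conj_commute eq_commute)

lemma finite_card_words: "finite (card_words m n)"
  by (rule finite_subset[OF _ finite_lists_length_eq[of "{1..n}" "m * n"]])
    (auto simp: card_words_def)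

lemma card_words_length: "w \<in> card_words m n \<Longrightarrow> length w = m * n"
  by (simp add: card_words_def)

lemma card_positions:
  "w \<in> card_words m n \<Longrightarrow> i \<in> {1..n} \<Longrightarrow> card {u. u < m * n \<and> w ! u = i} = m"
  using count_list_eq_card[of w i] by (simp add: card_words_def)

lemma swap_card_words:
  assumes "w \<in> card_words m n" "s < m * n" "t < m * n"
  shows "swap s t w \<in> card_words m n"
proof -
  have ms: "mset (swap s t w) = mset w"
    using assms by (intro mset_of_swap) (auto simp: card_words_length)
  have "set (swap s t w) = set w" using ms by (metis set_mset_mset)
  moreover have "count_list (swap s t w) i = count_list w i" for i
    using ms by (metis count_mset)
  ultimately show ?thesis using assms(1) by (simp add: card_words_def)
qed

lemma inj_on_swap: "s < m * n \<Longrightarrow> t < m * n \<Longrightarrow> inj_on (swap s t) (card_words m n)"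
  by (rule inj_on_inverseI[where g = "swap s t"]) (simp add: card_words_length swap_swap)

lemma card_words_nonempty: "card_words m n \<noteq> {}"
proof -
  define w where "w = concat (map (replicate m) [1..<Suc n])"
  have len: "length w = m * n"
    unfolding w_def by (simp add: length_concat comp_def sum_list_triv mult.commute del: upt_Suc)
  have "count_list (replicate k x) i = (if x = i then k else 0)" for k and x i :: nat
    by (induction k) auto
  then have "count_list (concat (map (replicate m) xs)) i = m * count_list xs i" for xs and i :: nat
    by (induction xs) (auto simp: count_list_append)
  then have "count_list w i = m * count_list [1..<Suc n] i" for i
    unfolding w_def by blast
  moreover have "distinct xs \<Longrightarrow> i \<in> set xs \<Longrightarrow> count_list xs i = 1" for xs and i :: nat
    by (induction xs) auto
  then have "count_list [1..<Suc n] i = 1" if "i \<in> {1..n}" for i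
    using that by (simp del: upt_Suc)
  ultimately have "w \<in> card_words m n"
    using len by (auto simp: card_words_def w_def simp del: upt_Suc)
  then show ?thesis by auto
qed

lemma play_eqI:
  "(\<And>s. s < t \<Longrightarrow> (g (play g w s) = w ! s) = (g (play g w s) = v ! s)) \<Longrightarrow>
    play g v t = play g w t"
proof (induction t)
  case (Suc t)
  then have "play g v t = play g w t" by simp
  then show ?case using Suc.prems[of t] by (simp add: Let_def)
qed simp

lemma play_eqD:
  assumes "play g v t = play g w t"
  shows "s \<le> t \<Longrightarrow> play g v s = play g w s"
    and "s < t \<Longrightarrow> (g (play g v s) = v ! s) = (g (play g w s) = w ! s)"
proof -
  have *: "play g v t = play g w t \<Longrightarrow> (\<forall>s\<le>t. play g v s = play g w s) \<and>
      (\<forall>s<t. (g (play g v s) = v ! s) = (g (play g w s) = w ! s))"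
    by (induction t) (auto simp: Let_def le_Suc_eq less_Suc_eq)
  show "s \<le> t \<Longrightarrow> play g v s = play g w s"
    and "s < t \<Longrightarrow> (g (play g v s) = v ! s) = (g (play g w s) = w ! s)"
    using *[OF assms] by blast+
qed

lemma play_swap_future:
  assumes "t \<le> u" "u < length w" "t' \<le> t"
  shows "play g (swap t u w) t' = play g w t'"
  using assms by (intro play_eqI) (auto simp: nth_swap)

text \<open>The history records of a missed round only that its card was not the guess. It therefore
  survives any exchange that brings to this round another card different from the guess.\<close>

lemma play_swap_past:
  assumes "s < t" "t < length w" "w ! s \<noteq> g (play g w s)" "w ! t \<noteq> g (play g w s)"
  shows "play g (swap s t w) t = play g w t"
  using assms by (intro play_eqI) (auto simp: nth_swap)

section \<open>The posterior hit probability\<close>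

locale guessing_rule =
  fixes g :: "history \<Rightarrow> nat" and m n :: nat
  assumes label: "g h \<in> {1..n}"
begin

abbreviation \<Omega> where "\<Omega> \<equiv> card_words m n"

definition G :: "nat list \<Rightarrow> nat \<Rightarrow> nat" where
  "G w t = g (play g w t)"

definition Y :: "nat list \<Rightarrow> nat \<Rightarrow> real" where
  "Y w t = of_bool (G w t = w ! t)"

definition hit_prob :: "nat list \<Rightarrow> nat \<Rightarrow> real" where
  "hit_prob w t = fibre_avg \<Omega> (\<lambda>v. play g v t) (\<lambda>v. Y v t) w"

text \<open>Among the past rounds whose card is the label guessed at \<open>t\<close>, these are the ones for which
  the exchange with round \<open>t\<close> may alter the history.\<close>

definition crossings :: "nat list \<Rightarrow> nat \<Rightarrow> nat set" where
  "crossings w t = {s. s < t \<and> w ! s = G w t \<and> w ! t = G w s}"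

definition crossing_avg :: "nat list \<Rightarrow> nat \<Rightarrow> real" where
  "crossing_avg w t = fibre_avg \<Omega> (\<lambda>v. play g v t) (\<lambda>v. card (crossings v t)) w"

text \<open>For a fixed label \<open>i\<close> this is a martingale in the number of rounds.\<close>

definition excess :: "nat list \<Rightarrow> nat \<Rightarrow> nat \<Rightarrow> real" where
  "excess w = label_sum (G w) (\<lambda>s. Y w s - hit_prob w s)"

text \<open>Count the \<open>m\<close> copies of the guessed label \<open>i\<close> by position, over the class \<open>c\<close> of words
  sharing the history of \<open>w\<close>; \<open>q u\<close> is the number of these words with \<open>i\<close> at \<open>u\<close>. Unseen
  positions are exchangeable, so each contributes at most \<open>q t\<close>. At a past guess of \<open>i\<close> the feedback
  decides the card, which gives the hits. At a past hit of another label there is no \<open>i\<close>. At a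
  past miss of another label, exchange with position \<open>t\<close> gives at most \<open>q t\<close> plus the crossings.\<close>

lemma hit_prob_lower_bound:
  assumes w: "w \<in> \<Omega>" and t: "t < m * n"
  shows "m - label_sum (G w) (Y w) (G w t) t - crossing_avg w t
    \<le> (m * n - label_sum (G w) (\<lambda>_. 1) (G w t) t) * hit_prob w t"
proof -
  define c where "c = {v \<in> \<Omega>. play g v t = play g w t}"
  define i where "i = G w t"
  define q where "q = (\<lambda>u. card {v \<in> c. v ! u = i})"
  define x where "x = (\<lambda>s. card {v \<in> c. v ! s = i \<and> v ! t = G w s})"
  have i: "i \<in> {1..n}" using label by (simp add: i_def G_def)
  have fin: "finite c" using finite_card_words by (simp add: c_def)
  have wc: "w \<in> c" using w by (simp add: c_def)
  have len: "length v = m * n" if "v \<in> c" for v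
    using that by (simp add: c_def card_words_length)
  have same: "s \<le> t \<Longrightarrow> G v s = G w s" "s < t \<Longrightarrow> (G w s = v ! s) = (G w s = w ! s)"
    if "v \<in> c" for v s
    using that play_eqD[of g v t w s] by (auto simp: c_def G_def)
  have future: "q u \<le> q t" if u: "u \<in> {t..<m * n}" for u
    unfolding q_def
  proof (rule card_inj_on_le[where f = "swap t u"])
    show "inj_on (swap t u) {v \<in> c. v ! u = i}"
      by (rule inj_on_subset[OF inj_on_swap[of t m n u]]) (use t u in \<open>auto simp: c_def\<close>)
    show "swap t u ` {v \<in> c. v ! u = i} \<subseteq> {v \<in> c. v ! t = i}"
      using t u by (auto simp: c_def nth_swap card_words_length play_swap_future swap_card_words)
  qed (use fin in auto)
  have past: "q s \<le> q t + x s" if s: "s < t" "G w s \<noteq> i" "G w s \<noteq> w ! s" for s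
  proof -
    have "card {v \<in> c. v ! s = i \<and> v ! t \<noteq> G w s} \<le> q t"
      unfolding q_def
    proof (rule card_inj_on_le[where f = "swap s t"])
      show "inj_on (swap s t) {v \<in> c. v ! s = i \<and> v ! t \<noteq> G w s}"
        by (rule inj_on_subset[OF inj_on_swap[of s m n t]]) (use t s in \<open>auto simp: c_def\<close>)
      show "swap s t ` {v \<in> c. v ! s = i \<and> v ! t \<noteq> G w s} \<subseteq> {v \<in> c. v ! t = i}"
      proof clarify
        fix v assume v: "v \<in> c" "i = v ! s" "v ! t \<noteq> G w s"
        have "play g (swap s t v) t = play g v t"
          using same[OF v(1), of s] s v t len[OF v(1)]
          by (intro play_swap_past) (auto simp: G_def)
        then show "swap s t v \<in> c \<and> swap s t v ! t = v ! s"
          using v s t by (auto simp: c_def nth_swap card_words_length swap_card_words)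
      qed
    qed (use fin in auto)
    moreover have "q s = card {v \<in> c. v ! s = i \<and> v ! t \<noteq> G w s} + x s"
      unfolding q_def x_def using fin
      by (subst card_Un_disjoint[symmetric]) (auto intro!: arg_cong[where f = card])
    ultimately show ?thesis by simp
  qed
  have q_past: "q s \<le> (if G w s = i then card c * Y w s else q t + x s)" if s: "s < t" for s
  proof (cases "G w s = w ! s")
    case True
    then have "v ! s = G w s" if "v \<in> c" for v using same(2)[OF that s] by simp
    then have "{v \<in> c. v ! s = i} = (if G w s = i then c else {})" by auto
    then have "q s = (if G w s = i then card c else 0)" by (simp add: q_def)
    then show ?thesis using True by (simp add: Y_def)
  next
    case False
    then have "v ! s \<noteq> G w s" if "v \<in> c" for v using same(2)[OF that s] by simp
    then have "{v \<in> c. v ! s = G w s} = {}" by auto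
    then have "card {v \<in> c. v ! s = G w s} = 0" by (simp only: card.empty)
    then have "G w s = i \<Longrightarrow> q s = 0" by (simp add: q_def)
    then show ?thesis using False past[OF s] by (auto simp: Y_def simp flip: of_nat_add)
  qed
  have x_sum: "(\<Sum>s<t. if G w s = i then 0 else real (x s)) \<le> card c * crossing_avg w t"
  proof -
    have "(\<Sum>s<t. if G w s = i then 0 else real (x s)) \<le> (\<Sum>s<t. real (x s))"
      by (intro sum_mono) auto
    also have "\<dots> = real (\<Sum>s\<in>{..<t}. \<Sum>v\<in>{v \<in> c. v ! s = i \<and> v ! t = G w s}. 1)"
      by (simp add: x_def)
    also have "\<dots> = real (\<Sum>v\<in>c. \<Sum>s\<in>{s \<in> {..<t}. v ! s = i \<and> v ! t = G w s}. 1)"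
      using fin by (subst sum.swap_restrict) auto
    also have "\<dots> = (\<Sum>v\<in>c. real (card (crossings v t)))"
      unfolding of_nat_sum
    proof (rule sum.cong[OF refl])
      fix v assume "v \<in> c"
      then have "{s \<in> {..<t}. v ! s = i \<and> v ! t = G w s} = crossings v t"
        using same(1)[of v] by (auto simp: crossings_def i_def)
      then show "(\<Sum>s\<in>{s \<in> {..<t}. v ! s = i \<and> v ! t = G w s}. real 1) = card (crossings v t)"
        by simp
    qed
    also have "\<dots> = card c * crossing_avg w t"
      using wc fin by (auto simp: crossing_avg_def fibre_avg_def c_def[symmetric])
    finally show ?thesis .
  qed
  have q_t: "q t = card c * hit_prob w t"
  proof -
    have "(\<Sum>v\<in>c. Y v t) = (\<Sum>v\<in>c. if v ! t = i then 1 else 0)"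
      using same(1)[of _ t] by (intro sum.cong) (auto simp: Y_def i_def)
    also have "\<dots> = q t" using fin by (simp add: q_def sum.If_cases Int_def)
    finally show ?thesis
      using wc fin by (auto simp: hit_prob_def fibre_avg_def c_def[symmetric])
  qed
  have "m * card c = (\<Sum>v\<in>c. \<Sum>u\<in>{u \<in> {..<m * n}. v ! u = i}. 1)"
    using i card_positions by (simp add: c_def)
  also have "\<dots> = (\<Sum>u<m * n. q u)"
    using fin by (subst sum.swap_restrict) (auto simp: q_def)
  also have "\<dots> = (\<Sum>u<t. q u) + (\<Sum>u=t..<m * n. q u)"
    using t by (metis atLeast0LessThan less_imp_le sum.atLeastLessThan_concat zero_le)
  finally have "real (m * card c) = (\<Sum>u<t. real (q u)) + (\<Sum>u=t..<m * n. real (q u))"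
    by simp
  also have "(\<Sum>u=t..<m * n. real (q u)) \<le> (\<Sum>u=t..<m * n. real (q t))"
    by (intro sum_mono) (use future in auto)
  also have "\<dots> = (m * n - t) * real (q t)" using t by (simp add: of_nat_diff)
  also have "(\<Sum>u<t. real (q u)) \<le> (\<Sum>s<t. if G w s = i then card c * Y w s else q t + x s)"
    by (intro sum_mono) (use q_past in auto)
  also have "\<dots> = (\<Sum>s<t. card c * (if G w s = i then Y w s else 0)
      + q t * (1 - (if G w s = i then 1 else 0 :: real)) + (if G w s = i then 0 else real (x s)))"
    by (intro sum.cong) auto
  also have "\<dots> = card c * label_sum (G w) (Y w) i t
      + q t * (t - label_sum (G w) (\<lambda>_. 1) i t) + (\<Sum>s<t. if G w s = i then 0 else real (x s))"
    by (simp add: sum.distrib sum_subtractf label_sum_def flip: sum_distrib_left)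
  also note x_sum
  finally have "card c * real m \<le> card c * (label_sum (G w) (Y w) i t
      + hit_prob w t * (t - label_sum (G w) (\<lambda>_. 1) i t) + crossing_avg w t
      + (m * n - t) * hit_prob w t)"
    by (simp add: q_t algebra_simps)
  moreover have "0 < real (card c)" using wc fin by (auto simp: card_gt_0_iff)
  ultimately have "m \<le> label_sum (G w) (Y w) i t
      + hit_prob w t * (t - label_sum (G w) (\<lambda>_. 1) i t) + crossing_avg w t
      + (m * n - t) * hit_prob w t"
    by (simp only: mult_le_cancel_left_pos)
  then show ?thesis using t by (simp add: i_def algebra_simps of_nat_diff)
qed

text \<open>The guesses up to round \<open>t\<close> depend only on the cards before \<open>t\<close>, so position \<open>t\<close> may
  be replaced by a uniformly chosen unseen position. Summed over those positions, there are at most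
  \<open>m\<close> candidates \<open>s\<close> with the right card, and for each at most \<open>m\<close> positions carrying the label
  guessed at \<open>s\<close>.\<close>

lemma sum_crossing_avg:
  assumes t: "t < m * n"
  shows "(m * n - t) * (\<Sum>w\<in>\<Omega>. crossing_avg w t) \<le> card \<Omega> * (real m)\<^sup>2"
proof -
  define K where "K = (\<lambda>w u. {s. s < t \<and> w ! s = G w t \<and> w ! u = G w s})"
  have swap_K: "K (swap t u w) t = K w u" if "w \<in> \<Omega>" "u \<in> {t..<m * n}" for w u
  proof -
    have "G (swap t u w) s = G w s" if "s \<le> t" for s
      using that \<open>w \<in> \<Omega>\<close> \<open>u \<in> _\<close> by (simp add: G_def play_swap_future card_words_length)
    then show ?thesis
      using that by (auto simp: K_def nth_swap card_words_length)
  qed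
  have exch: "(\<Sum>w\<in>\<Omega>. card (K w t)) = (\<Sum>w\<in>\<Omega>. card (K w u))" if u: "u \<in> {t..<m * n}" for u
  proof (rule sum.reindex_bij_witness[where i = "swap t u" and j = "swap t u"])
    fix w assume w: "w \<in> \<Omega>"
    show inv: "swap t u (swap t u w) = w" "swap t u (swap t u w) = w"
      and mem: "swap t u w \<in> \<Omega>" "swap t u w \<in> \<Omega>"
      using w t u by (auto simp: swap_swap card_words_length swap_card_words)
    show "card (K (swap t u w) u) = card (K w t)"
      using swap_K[OF mem(1) u] inv(1) by simp
  qed
  have bound: "(\<Sum>u=t..<m * n. card (K w u)) \<le> m * m" if w: "w \<in> \<Omega>" for w
  proof -
    have "(\<Sum>u=t..<m * n. card (K w u))
        = (\<Sum>u=t..<m * n. \<Sum>s\<in>{s \<in> {s. s < t \<and> w ! s = G w t}. w ! u = G w s}. 1)"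
      by (simp add: K_def conj_assoc)
    also have "\<dots> = (\<Sum>s\<in>{s. s < t \<and> w ! s = G w t}. \<Sum>u\<in>{u \<in> {t..<m * n}. w ! u = G w s}. 1)"
      by (rule sum.swap_restrict) auto
    also have "\<dots> \<le> (\<Sum>s\<in>{s. s < t \<and> w ! s = G w t}. m)"
    proof (rule sum_mono)
      fix s
      have "card {u \<in> {t..<m * n}. w ! u = G w s} \<le> card {u. u < m * n \<and> w ! u = G w s}"
        by (intro card_mono) auto
      then show "(\<Sum>u\<in>{u \<in> {t..<m * n}. w ! u = G w s}. 1) \<le> m"
        using card_positions[OF w, of "G w s"] label by (simp add: G_def)
    qed
    also have "\<dots> \<le> m * m"
    proof -
      have "card {s. s < t \<and> w ! s = G w t} \<le> card {u. u < m * n \<and> w ! u = G w t}"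
        using t by (intro card_mono) auto
      then show ?thesis using card_positions[OF w, of "G w t"] label by (simp add: G_def)
    qed
    finally show ?thesis .
  qed
  have "(m * n - t) * (\<Sum>w\<in>\<Omega>. card (K w t)) = (\<Sum>u=t..<m * n. \<Sum>w\<in>\<Omega>. card (K w t))" by simp
  also have "\<dots> = (\<Sum>u=t..<m * n. \<Sum>w\<in>\<Omega>. card (K w u))" by (intro sum.cong exch) auto
  also have "\<dots> = (\<Sum>w\<in>\<Omega>. \<Sum>u=t..<m * n. card (K w u))" by (rule sum.swap)
  also have "\<dots> \<le> (\<Sum>w\<in>\<Omega>. m * m)" by (intro sum_mono bound)
  also have "\<dots> = card \<Omega> * (m * m)" by simp
  finally have "real ((m * n - t) * (\<Sum>w\<in>\<Omega>. card (K w t))) \<le> real (card \<Omega> * (m * m))"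
    by (rule of_nat_mono)
  moreover have "(\<Sum>w\<in>\<Omega>. crossing_avg w t) = real (\<Sum>w\<in>\<Omega>. card (K w t))"
    unfolding crossing_avg_def
    by (simp add: sum_fibre_avg finite_card_words crossings_def K_def)
  ultimately show ?thesis using t by (simp add: of_nat_diff power2_eq_square)
qed

lemma history_determines:
  assumes "play g v t = play g w t"
  shows "G v t = G w t" "hit_prob v t = hit_prob w t" "excess v i t = excess w i t"
proof -
  have eq: "play g v s = play g w s" if "s \<le> t" for s using play_eqD(1)[OF assms that] .
  show G: "G v t = G w t" by (simp add: G_def assms)
  show "hit_prob v t = hit_prob w t"
    unfolding hit_prob_def by (rule fibre_avg_cong) (rule assms)
  have "G v s = G w s \<and> Y v s = Y w s \<and> hit_prob v s = hit_prob w s" if s: "s < t" for s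
  proof -
    have "hit_prob v s = hit_prob w s"
      unfolding hit_prob_def by (rule fibre_avg_cong) (use eq s in simp)
    then show ?thesis using play_eqD(2)[OF assms s] eq[of s] s by (simp add: G_def Y_def)
  qed
  then show "excess v i t = excess w i t" unfolding excess_def by (intro label_sum_cong) auto
qed

lemma sum_mult_hit_prob:
  assumes "\<And>v w. play g v t = play g w t \<Longrightarrow> k v = k w"
  shows "(\<Sum>w\<in>\<Omega>. k w * hit_prob w t) = (\<Sum>w\<in>\<Omega>. k w * Y w t)"
  unfolding hit_prob_def using assms by (intro sum_mult_fibre_avg finite_card_words) blast

lemma sum_hit_prob: "(\<Sum>w\<in>\<Omega>. hit_prob w t) = (\<Sum>w\<in>\<Omega>. Y w t)"
  using sum_mult_hit_prob[of t "\<lambda>_. 1"] by simp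

text \<open>In each round only the martingale of the guessed label moves, the increment is orthogonal to
  the past, and its conditional variance \<open>p (1 - p)\<close> is at most the hit probability \<open>p\<close>. So the
  sum over all labels grows no faster than the score, whatever the number of labels; this is what
  makes a choice of label depending on the history harmless.\<close>

lemma sum_excess_squared:
  "(\<Sum>w\<in>\<Omega>. \<Sum>i\<in>{1..n}. (excess w i t)\<^sup>2) \<le> (\<Sum>w\<in>\<Omega>. \<Sum>s<t. Y w s)"
proof (induction t)
  case (Suc t)
  define d where "d = (\<lambda>w. Y w t - hit_prob w t)"
  have step: "(\<Sum>i\<in>{1..n}. (excess w i (Suc t))\<^sup>2)
      = (\<Sum>i\<in>{1..n}. (excess w i t)\<^sup>2) + (2 * excess w (G w t) t * d w + (d w)\<^sup>2)" for w
  proof -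
    have "(\<Sum>i\<in>{1..n}. (excess w i (Suc t))\<^sup>2) = (\<Sum>i\<in>{1..n}. (excess w i t)\<^sup>2
        + (if G w t = i then 2 * excess w (G w t) t * d w + (d w)\<^sup>2 else 0))"
      by (intro sum.cong refl)
        (auto simp: excess_def label_sum_Suc d_def power2_eq_square algebra_simps)
    also have "\<dots> = (\<Sum>i\<in>{1..n}. (excess w i t)\<^sup>2) + (2 * excess w (G w t) t * d w + (d w)\<^sup>2)"
      using label by (simp add: sum.distrib G_def)
    finally show ?thesis .
  qed
  have cross: "(\<Sum>w\<in>\<Omega>. 2 * excess w (G w t) t * d w) = 0"
  proof -
    have "2 * excess v (G v t) t = 2 * excess w (G w t) t" if "play g v t = play g w t" for v w
      using history_determines[OF that] by simp
    from sum_mult_hit_prob[of t "\<lambda>w. 2 * excess w (G w t) t", OF this] show ?thesis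
      by (simp add: d_def right_diff_distrib sum_subtractf)
  qed
  have "(\<Sum>w\<in>\<Omega>. (d w)\<^sup>2) = (\<Sum>w\<in>\<Omega>. Y w t - (hit_prob w t)\<^sup>2)"
  proof -
    have "Y w t * Y w t = Y w t" for w by (simp add: Y_def)
    then have "(d w)\<^sup>2 = Y w t - 2 * (hit_prob w t * Y w t) + (hit_prob w t)\<^sup>2" for w
      by (simp add: d_def power2_diff) (simp add: power2_eq_square mult_ac)
    moreover have "(\<Sum>w\<in>\<Omega>. hit_prob w t * hit_prob w t) = (\<Sum>w\<in>\<Omega>. hit_prob w t * Y w t)"
      by (rule sum_mult_hit_prob) (rule history_determines)
    ultimately show ?thesis
      by (simp add: sum.distrib sum_subtractf flip: sum_distrib_left)
        (simp add: power2_eq_square)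
  qed
  also have "\<dots> \<le> (\<Sum>w\<in>\<Omega>. Y w t)" by (intro sum_mono) simp
  finally have "(\<Sum>w\<in>\<Omega>. (d w)\<^sup>2) \<le> (\<Sum>w\<in>\<Omega>. Y w t)" .
  then show ?case using Suc cross by (simp only: step sum.distrib sum.lessThan_Suc)
qed (simp add: excess_def)

text \<open>The hypothesis on the mean score keeps the mean squares of the martingales below \<open>m\<close>; a
  larger score is good enough anyway.\<close>

lemma sum_hits_ge:
  assumes m: "0 < m" and T: "T < m * n"
    and small: "(\<Sum>w\<in>\<Omega>. \<Sum>s<T. Y w s) \<le> card \<Omega> * real m"
  shows "card \<Omega> * (T / n - T / real (m * n - T) * (sqrt m + (real m)\<^sup>2 / real (m * n - T)))
    \<le> (\<Sum>w\<in>\<Omega>. \<Sum>s<T. Y w s)"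
proof -
  define r where "r = real (m * n - T)"
  have r: "0 < r" using T by (simp only: r_def of_nat_0_less_iff zero_less_diff)
  have n: "0 < n" using label[of "[]"] by simp
  have avg_excess: "(\<Sum>w\<in>\<Omega>. \<bar>excess w (G w t) t\<bar>) \<le> card \<Omega> * sqrt m" if t: "t < T" for t
  proof -
    have "\<bar>excess w (G w t) t\<bar> \<le> (sqrt m + (\<Sum>i\<in>{1..n}. (excess w i t)\<^sup>2) / sqrt m) / 2" for w
    proof -
      \<comment> \<open>the arithmetic-geometric mean inequality, in place of Cauchy-Schwarz\<close>
      let ?x = "\<bar>excess w (G w t) t\<bar>"
      have "0 \<le> (sqrt m - ?x)\<^sup>2" by simp
      then have "?x * 2 * sqrt m \<le> m + (excess w (G w t) t)\<^sup>2"
        by (simp add: power2_diff mult_ac)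
      also have "(excess w (G w t) t)\<^sup>2 \<le> (\<Sum>i\<in>{1..n}. (excess w i t)\<^sup>2)"
        using label by (intro member_le_sum) (auto simp: G_def)
      finally have "?x * 2 \<le> (m + (\<Sum>i\<in>{1..n}. (excess w i t)\<^sup>2)) / sqrt m"
        using m by (simp add: pos_le_divide_eq)
      also have "\<dots> = sqrt m + (\<Sum>i\<in>{1..n}. (excess w i t)\<^sup>2) / sqrt m"
        using m by (simp add: add_divide_distrib real_div_sqrt)
      finally show ?thesis by simp
    qed
    then have "(\<Sum>w\<in>\<Omega>. \<bar>excess w (G w t) t\<bar>)
        \<le> (\<Sum>w\<in>\<Omega>. (sqrt m + (\<Sum>i\<in>{1..n}. (excess w i t)\<^sup>2) / sqrt m) / 2)"
      by (rule sum_mono)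
    also have "\<dots> = (card \<Omega> * sqrt m + (\<Sum>w\<in>\<Omega>. \<Sum>i\<in>{1..n}. (excess w i t)\<^sup>2) / sqrt m) / 2"
      by (simp add: sum.distrib flip: sum_divide_distrib)
    also have "\<dots> \<le> (card \<Omega> * sqrt m + card \<Omega> * real m / sqrt m) / 2"
    proof -
      have "(\<Sum>w\<in>\<Omega>. \<Sum>s<t. Y w s) \<le> (\<Sum>w\<in>\<Omega>. \<Sum>s<T. Y w s)"
        using t by (intro sum_mono sum_mono2) (auto simp: Y_def)
      then show ?thesis
        using sum_excess_squared[of t] small by (intro divide_right_mono add_left_mono) auto
    qed
    also have "\<dots> = card \<Omega> * sqrt m"
      using m by (simp add: real_div_sqrt flip: times_divide_eq_right)
    finally show ?thesis .
  qed
  have avg_eps: "(\<Sum>w\<in>\<Omega>. crossing_avg w t) \<le> card \<Omega> * (m\<^sup>2 / r)" if t: "t < T" for t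
  proof -
    have "0 \<le> (\<Sum>w\<in>\<Omega>. crossing_avg w t)"
      unfolding crossing_avg_def by (intro sum_nonneg fibre_avg_nonneg) simp
    then have "r * (\<Sum>w\<in>\<Omega>. crossing_avg w t) \<le> (m * n - t) * (\<Sum>w\<in>\<Omega>. crossing_avg w t)"
      using t by (intro mult_right_mono) (auto simp: r_def intro!: diff_le_mono2)
    also have "\<dots> \<le> card \<Omega> * (real m)\<^sup>2" using sum_crossing_avg[of t] t T by simp
    finally show ?thesis using r by (simp add: field_simps)
  qed
  have path: "T / n - (\<Sum>t<T. (\<bar>excess w (G w t) t\<bar> + crossing_avg w t) / r) \<le> (\<Sum>t<T. hit_prob w t)"
    if w: "w \<in> \<Omega>" for w
  proof -
    have pos: "0 \<le> crossing_avg w t" for t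
      unfolding crossing_avg_def by (intro fibre_avg_nonneg) simp
    have "T / n - (\<Sum>t<T. (\<bar>excess w (G w t) t\<bar> + crossing_avg w t) / (m * n - t))
        \<le> (\<Sum>t<T. hit_prob w t)"
      unfolding excess_def
      by (rule sum_rates_ge[where Y = "Y w" and m = m and N = "m * n" and n = n and G = "G w",
            simplified of_nat_mult])
        (use n T label w pos hit_prob_lower_bound in \<open>auto simp: G_def\<close>)
    moreover have "(\<Sum>t<T. (\<bar>excess w (G w t) t\<bar> + crossing_avg w t) / (m * n - t))
        \<le> (\<Sum>t<T. (\<bar>excess w (G w t) t\<bar> + crossing_avg w t) / r)"
      using r pos T by (intro sum_mono frac_le) (auto simp: r_def intro!: diff_le_mono2)
    ultimately show ?thesis by linarith
  qed
  have "card \<Omega> * (T / n - T / r * (sqrt m + m\<^sup>2 / r))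
      = card \<Omega> * (T / n) - (\<Sum>t<T. (card \<Omega> * sqrt m + card \<Omega> * (m\<^sup>2 / r)) / r)"
    by (simp add: algebra_simps add_divide_distrib)
  also have "\<dots> \<le> card \<Omega> * (T / n)
      - (\<Sum>t<T. ((\<Sum>w\<in>\<Omega>. \<bar>excess w (G w t) t\<bar>) + (\<Sum>w\<in>\<Omega>. crossing_avg w t)) / r)"
    using r avg_excess avg_eps by (intro diff_left_mono sum_mono divide_right_mono add_mono) auto
  also have "\<dots> = card \<Omega> * (T / n) - (\<Sum>t<T. \<Sum>w\<in>\<Omega>. (\<bar>excess w (G w t) t\<bar> + crossing_avg w t) / r)"
    by (simp add: sum.distrib sum_divide_distrib add_divide_distrib)
  also have "\<dots> = (\<Sum>w\<in>\<Omega>. T / n - (\<Sum>t<T. (\<bar>excess w (G w t) t\<bar> + crossing_avg w t) / r))"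
    by (subst sum.swap) (simp add: sum_subtractf)
  also have "\<dots> \<le> (\<Sum>w\<in>\<Omega>. \<Sum>t<T. hit_prob w t)" by (intro sum_mono path)
  also have "\<dots> = (\<Sum>t<T. \<Sum>w\<in>\<Omega>. hit_prob w t)" by (rule sum.swap)
  also have "\<dots> = (\<Sum>t<T. \<Sum>w\<in>\<Omega>. Y w t)" by (simp add: sum_hit_prob)
  also have "\<dots> = (\<Sum>w\<in>\<Omega>. \<Sum>t<T. Y w t)" by (rule sum.swap)
  finally show ?thesis by (simp add: r_def)
qed

lemma score_eq: "w \<in> \<Omega> \<Longrightarrow> score g w = (\<Sum>t<m * n. Y w t)"
  by (simp add: score_def Y_def G_def card_words_length)

text \<open>Put \<open>r = m powr (1/4)\<close> and cut at \<open>N - T \<ge> N / r\<close>. The last rounds cost \<open>r\<^sup>3 + 1 / n\<close>,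
  where \<open>1 / n\<close> comes from rounding \<open>T\<close>, the martingales cost \<open>r * r\<^sup>2\<close>, and the crossings cost
  \<open>r * (r ^ 5 / n) \<le> r\<^sup>2\<close> as \<open>n \<ge> m = r ^ 4\<close>. The third multiple of \<open>r\<^sup>3\<close> absorbs
  \<open>r\<^sup>2 + 1 / n\<close> once \<open>r > 3\<close>; for \<open>r \<le> 3\<close> the claimed bound is not positive.\<close>

lemma sum_score_ge:
  assumes m: "0 < m" "m \<le> n"
  shows "card \<Omega> * (m - 3 * m powr (3 / 4)) \<le> (\<Sum>w\<in>\<Omega>. real (score g w))"
proof -
  define r where "r = real m powr (1 / 4)"
  have r: "0 < r" using m by (simp add: r_def)
  have r_pow: "r ^ k = real m powr (k / 4)" for k
    using m by (simp add: r_def powr_powr flip: powr_realpow)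
  have r4: "r ^ 4 = m" and r3: "r ^ 3 = m powr (3 / 4)" using m by (simp_all add: r_pow)
  have r2: "sqrt m = r\<^sup>2" using r by (simp flip: r4 add: real_sqrt_unique)
  have card: "0 < real (card \<Omega>)"
    using finite_card_words card_words_nonempty by (simp add: card_gt_0_iff)
  have score0: "0 \<le> (\<Sum>w\<in>\<Omega>. real (score g w))" by (intro sum_nonneg of_nat_0_le_iff)
  consider "r \<le> 3" | "3 < r" "(\<Sum>w\<in>\<Omega>. real (score g w)) \<le> card \<Omega> * real m"
    | "card \<Omega> * real m \<le> (\<Sum>w\<in>\<Omega>. real (score g w))" by linarith
  then show ?thesis
  proof cases
    case 1
    have "r ^ 4 - 3 * r ^ 3 = r ^ 3 * (r - 3)"
      by (simp add: algebra_simps power4_eq_xxxx power3_eq_cube)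
    then have "m - 3 * m powr (3 / 4) = r ^ 3 * (r - 3)" by (simp add: r3 r4)
    also have "\<dots> \<le> 0" using 1 r by (simp add: mult_nonneg_nonpos)
    finally have "card \<Omega> * (m - 3 * m powr (3 / 4)) \<le> 0" using card by (simp add: mult_le_0_iff)
    then show ?thesis using score0 by linarith
  next
    case 3
    have "card \<Omega> * (m - 3 * m powr (3 / 4)) \<le> card \<Omega> * real m"
      by (intro mult_left_mono) auto
    then show ?thesis using 3 by linarith
  next
    case 2
    define N where "N = real (m * n)"
    define \<delta> where "\<delta> = N / r"
    define T where "T = nat \<lfloor>N - \<delta>\<rfloor>"
    have N: "0 < N" using m by (simp add: N_def)
    have \<delta>: "0 < \<delta>" "\<delta> < N" using N r 2 by (auto simp: \<delta>_def divide_less_eq)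
    have T: "N - \<delta> - 1 \<le> T" "T \<le> N - \<delta>" using \<delta> by (auto simp: T_def)
    have TN: "T < m * n" using T \<delta> by (simp add: N_def del: of_nat_mult)
    define d where "d = real (m * n - T)"
    have gap: "\<delta> \<le> d" using T TN by (simp add: of_nat_diff N_def d_def)
    have part: "(\<Sum>w\<in>\<Omega>. \<Sum>s<T. Y w s) \<le> (\<Sum>w\<in>\<Omega>. real (score g w))"
      using TN by (simp add: score_eq) (intro sum_mono sum_mono2, auto simp: Y_def)
    have "(\<Sum>w\<in>\<Omega>. \<Sum>s<T. Y w s) \<le> card \<Omega> * real m" using part 2 by linarith
    then have cut: "card \<Omega> * (T / n - T / d * (sqrt m + (real m)\<^sup>2 / d))
        \<le> (\<Sum>w\<in>\<Omega>. \<Sum>s<T. Y w s)"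
      using m TN unfolding d_def by (intro sum_hits_ge)
    have "m - 3 * m powr (3 / 4) \<le> T / n - T / d * (sqrt m + (real m)\<^sup>2 / d)"
    proof -
      have n: "r ^ 4 \<le> n" using m r4 by simp
      have N4: "N = r ^ 4 * n" by (simp add: N_def r4)
      have "T / d * (sqrt m + (real m)\<^sup>2 / d) \<le> N / \<delta> * (sqrt m + (real m)\<^sup>2 / \<delta>)"
        using gap \<delta> T by (intro mult_mono frac_le add_mono order_refl) (auto intro: add_nonneg_nonneg)
      also have "\<dots> = r * (r\<^sup>2 + r ^ 5 / n)"
      proof -
        have "(real m)\<^sup>2 = r ^ 5 * r ^ 3" by (simp flip: r4 power_mult power_add)
        moreover have "\<delta> = n * r ^ 3" using r by (simp add: \<delta>_def N4 field_simps power_eq_if)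
        ultimately have "(real m)\<^sup>2 / \<delta> = (r ^ 5 * r ^ 3) / (n * r ^ 3)" by (simp only:)
        also have "\<dots> = r ^ 5 / n"
          by (rule nonzero_mult_divide_mult_cancel_right) (use r in simp)
        finally have "(real m)\<^sup>2 / \<delta> = r ^ 5 / n" .
        moreover have "N / \<delta> = r" using r N by (simp add: \<delta>_def)
        ultimately show ?thesis by (simp add: r2)
      qed
      also have "\<dots> \<le> r * (r\<^sup>2 + r)"
        using n r m by (intro mult_left_mono add_left_mono) (auto simp: field_simps power_eq_if)
      finally have err: "T / d * (sqrt m + (real m)\<^sup>2 / d) \<le> r * (r\<^sup>2 + r)" .
      have "r ^ 4 - r ^ 3 - 1 / n = (N - \<delta> - 1) / n"
        using m r by (simp add: \<delta>_def N4 field_simps power_eq_if)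
      also have "\<dots> \<le> T / n" using T by (intro divide_right_mono) auto
      finally have main: "r ^ 4 - r ^ 3 - 1 / n \<le> T / n" .
      have "1 / n \<le> 1" using m by simp
      moreover have "1 * 3 \<le> r * r" using 2 by (intro mult_mono) auto
      moreover have "3 * (r * r) \<le> r * (r * r)" using 2 by (intro mult_right_mono) auto
      ultimately have "1 / n + r * (r\<^sup>2 + r) \<le> 2 * r ^ 3"
        by (simp add: algebra_simps power2_eq_square power3_eq_cube)
      then show ?thesis using err main r3 r4 by linarith
    qed
    then have "card \<Omega> * (m - 3 * m powr (3 / 4))
        \<le> card \<Omega> * (T / n - T / d * (sqrt m + (real m)\<^sup>2 / d))"
      by (intro mult_left_mono) auto
    then show ?thesis using cut part by linarith
  qed
qed

end

section \<open>Randomised strategies\<close>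

lemma score_le_length: "score g w \<le> length w"
  using sum_bounded_above[of "{..<length w}" "\<lambda>t. of_bool (g (play g w t) = w ! t)" "1 :: nat"]
  by (simp add: score_def)

text \<open>The history of a random rule is a random variable because it takes values in a countable set
  and each guess at a fixed history is one.\<close>

lemma measurable_score:
  assumes A: "\<And>h. (\<lambda>s. A s h) \<in> M \<rightarrow>\<^sub>M count_space {1..n}"
  shows "(\<lambda>s. real (score (A s) w)) \<in> borel_measurable M"
proof -
  have A': "(\<lambda>s. A s h) \<in> M \<rightarrow>\<^sub>M count_space UNIV" for h
    by (rule measurable_compose[OF A]) simp
  have play: "(\<lambda>s. play (A s) w t) \<in> M \<rightarrow>\<^sub>M count_space UNIV" for t
  proof (induction t)
    case (Suc t)
    have "(\<lambda>s. h @ [(A s h, A s h = w ! t)]) \<in> M \<rightarrow>\<^sub>M count_space UNIV" for h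
      using A'[of h] by measurable
    from measurable_compose_countable[OF this Suc] show ?case by (simp add: Let_def)
  qed simp
  have guess: "(\<lambda>s. A s (play (A s) w t)) \<in> M \<rightarrow>\<^sub>M count_space UNIV" for t
    by (rule measurable_compose_countable[OF A' play])
  have "(\<lambda>s. of_bool (A s (play (A s) w t) = w ! t) :: real) \<in> borel_measurable M" for t
    by (rule measurable_compose[OF guess]) simp
  then show ?thesis unfolding score_def of_nat_sum of_nat_of_bool by measurable
qed

text \<open>Conditionally on the seed the player follows a deterministic rule, so bounds valid for every
  rule pass to the expected score. Integrability matters here, since a non-integrable score would have
  the integral \<open>0\<close>.\<close>

lemma expected_score_eq:
  assumes "(M, A) \<in> strategies TYPE('s) n"
  shows "integrable M (\<lambda>s. (\<Sum>w\<in>card_words m n. real (score (A s) w)) / card (card_words m n))"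
    and "expected_score m n M A
      = (\<integral>s. (\<Sum>w\<in>card_words m n. real (score (A s) w)) / card (card_words m n) \<partial>M)"
proof -
  let ?W = "measure_pmf (pmf_of_set (card_words m n))"
  interpret M: prob_space M using assms by (simp add: strategies_def)
  interpret W: prob_space ?W by (rule measure_pmf.prob_space_axioms)
  interpret pair_sigma_finite M ?W ..
  have meas: "(\<lambda>s. real (score (A s) w)) \<in> borel_measurable M" for w
    using assms by (intro measurable_score) (auto simp: strategies_def)
  have "(\<lambda>(s, w). real (score (A s) w)) \<in> borel_measurable (M \<Otimes>\<^sub>M count_space UNIV)"
    unfolding case_prod_unfold
    by (rule measurable_compose_countable[where f = "\<lambda>w x. real (score (A (fst x)) w)" and g = snd])
      (use meas in measurable)
  then have pair: "(\<lambda>(s, w). real (score (A s) w)) \<in> borel_measurable (M \<Otimes>\<^sub>M ?W)"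
    by (simp add: sets_pair_measure_cong[OF refl sets_measure_pmf_count_space]
        cong: measurable_cong_sets)
  have inner: "(\<integral>w. f w \<partial>?W) = (\<Sum>w\<in>card_words m n. f w) / card (card_words m n)"
    for f :: "nat list \<Rightarrow> real"
    by (rule integral_pmf_of_set[OF card_words_nonempty finite_card_words])
  have one: "integrable M (\<lambda>s. real (score (A s) w))" for w
    by (rule M.integrable_const_bound[where B = "length w"])
      (use meas in \<open>auto simp: score_le_length\<close>)
  have int: "integrable M (\<lambda>s. (\<Sum>w\<in>card_words m n. real (score (A s) w)) / card (card_words m n))"
    using one by simp
  then show "integrable M (\<lambda>s. (\<Sum>w\<in>card_words m n. real (score (A s) w)) / card (card_words m n))" .
  have "integrable (M \<Otimes>\<^sub>M ?W) (\<lambda>(s, w). real (score (A s) w))"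
  proof (rule Fubini_integrable)
    show "integrable M (\<lambda>s. \<integral>w. norm (case (s, w) of (s, w) \<Rightarrow> real (score (A s) w)) \<partial>?W)"
      using int by (simp add: inner)
    show "AE s in M. integrable ?W (\<lambda>w. case (s, w) of (s, w) \<Rightarrow> real (score (A s) w))"
      by (intro AE_I2 integrable_measure_pmf_finite)
        (simp add: finite_card_words card_words_nonempty set_pmf_of_set)
  qed (rule pair)
  from integral_fst'[OF this] show "expected_score m n M A
      = (\<integral>s. (\<Sum>w\<in>card_words m n. real (score (A s) w)) / card (card_words m n) \<partial>M)"
    by (simp add: expected_score_def inner)
qed

lemma expected_score_ge:
  assumes st: "(M, A) \<in> strategies TYPE('s) n" and m: "0 < m" "m \<le> n"
  shows "m - 3 * m powr (3 / 4) \<le> expected_score m n M A"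
proof -
  interpret M: prob_space M using st by (simp add: strategies_def)
  have "m - 3 * m powr (3 / 4) \<le> (\<Sum>w\<in>card_words m n. real (score (A s) w)) / card (card_words m n)"
    if s: "s \<in> space M" for s
  proof -
    have "A s h \<in> {1..n}" for h
      using st s measurable_space[of "\<lambda>s. A s h" M "count_space {1..n}" s]
      by (simp add: strategies_def)
    then interpret guessing_rule "A s" m n by unfold_locales
    have "0 < card (card_words m n)"
      using finite_card_words card_words_nonempty by (simp add: card_gt_0_iff)
    then show ?thesis using sum_score_ge[OF m] by (simp add: field_simps)
  qed
  then have "(\<integral>s. m - 3 * m powr (3 / 4) \<partial>M)
      \<le> (\<integral>s. (\<Sum>w\<in>card_words m n. real (score (A s) w)) / card (card_words m n) \<partial>M)"
    by (intro integral_mono expected_score_eq(1)[OF st]) auto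
  then show ?thesis by (simp add: expected_score_eq(2)[OF st] M.prob_space)
qed

lemma constant_guess_strategy:
  assumes "0 < n"
  obtains M :: "'s measure" and A where "(M, A) \<in> strategies TYPE('s) n" "expected_score m n M A = m"
proof
  let ?M = "return (count_space UNIV) (undefined :: 's)"
  let ?A = "\<lambda>(s :: 's) (h :: history). 1 :: nat"
  interpret M: prob_space ?M by (rule prob_space_return) simp
  show st: "(?M, ?A) \<in> strategies TYPE('s) n"
    using assms M.prob_space_axioms by (simp add: strategies_def)
  have "score (\<lambda>h. 1) w = m" if "w \<in> card_words m n" for w
  proof -
    have "score (\<lambda>h. 1) w = card {t. t < length w \<and> w ! t = 1}"
      by (simp add: score_def sum_of_bool_eq Int_def eq_commute)
    then show ?thesis using that assms card_positions[of w m n 1]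
      by (simp add: card_words_length)
  qed
  moreover have "0 < card (card_words m n)"
    using finite_card_words card_words_nonempty by (simp add: card_gt_0_iff)
  ultimately show "expected_score m n ?M ?A = m"
    by (simp add: expected_score_eq(2)[OF st] M.prob_space[simplified] del: One_nat_def)
qed

lemma P_minus_bounds:
  assumes m: "0 < m" "m \<le> n"
  shows "P_minus TYPE('s) m n \<le> m" "m - 3 * m powr (3 / 4) \<le> P_minus TYPE('s) m n"
proof -
  obtain M :: "'s measure" and A where st: "(M, A) \<in> strategies TYPE('s) n"
    and exp: "expected_score m n M A = m"
    using constant_guess_strategy[of n m] m by auto
  have lower: "m - 3 * m powr (3 / 4) \<le> (case x of (M, A) \<Rightarrow> expected_score m n M A)"
    if "x \<in> strategies TYPE('s) n" for x
    using expected_score_ge that m by (cases x) auto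
  show "m - 3 * m powr (3 / 4) \<le> P_minus TYPE('s) m n"
    unfolding P_minus_def using st lower by (intro cINF_greatest) auto
  have "P_minus TYPE('s) m n \<le> (case (M, A) of (M, A) \<Rightarrow> expected_score m n M A)"
    unfolding P_minus_def using lower by (intro cINF_lower st bdd_belowI2) auto
  then show "P_minus TYPE('s) m n \<le> m" by (simp add: exp)
qed

theorem theorem1p1:
  shows "(\<forall>m n :: nat. 0 < m \<and> m \<le> n \<longrightarrow>
            0 \<le> real m - P_minus TYPE('s) m n \<and>
            real m - P_minus TYPE('s) m n \<le> 3 * real m powr (3 / 4)) \<and>
         (\<lambda>m :: nat. SUP n\<in>{m..}. ereal \<bar>P_minus TYPE('s) m n / real m - 1\<bar>) \<longlonglongrightarrow> 0"
proof (intro conjI allI impI)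
  fix m n :: nat assume "0 < m \<and> m \<le> n"
  then show "0 \<le> real m - P_minus TYPE('s) m n"
    and "real m - P_minus TYPE('s) m n \<le> 3 * real m powr (3 / 4)"
    using P_minus_bounds[of m n, where 's = 's] by (simp_all add: algebra_simps)
next
  let ?d = "\<lambda>m n. ereal \<bar>P_minus TYPE('s) m n / real m - 1\<bar>"
  have bound: "?d m n \<le> ereal (3 * real m powr (- 1 / 4))" if m: "0 < m" "m \<le> n" for m n
  proof -
    have "\<bar>P_minus TYPE('s) m n / real m - 1\<bar> = (m - P_minus TYPE('s) m n) / m"
      using P_minus_bounds(1)[OF m, where 's = 's] m by (simp add: field_simps)
    also have "\<dots> \<le> 3 * real m powr (3 / 4) / m"
      using P_minus_bounds(2)[OF m, where 's = 's] m by (intro divide_right_mono) auto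
    also have "\<dots> = 3 * real m powr (- 1 / 4)"
      using m powr_diff[of "real m" "3 / 4" 1] by simp
    finally show ?thesis by simp
  qed
  show "(\<lambda>m. SUP n\<in>{m..}. ?d m n) \<longlonglongrightarrow> 0"
  proof (rule tendsto_sandwich)
    show "\<forall>\<^sub>F m in sequentially. 0 \<le> (SUP n\<in>{m..}. ?d m n)"
      by (intro always_eventually allI SUP_upper2[where i = _]) auto
    show "\<forall>\<^sub>F m in sequentially. (SUP n\<in>{m..}. ?d m n) \<le> ereal (3 * real m powr (- 1 / 4))"
      using eventually_gt_at_top[of 0] by eventually_elim (intro SUP_least bound, auto)
    have "(\<lambda>m. 3 * real m powr (- 1 / 4)) \<longlonglongrightarrow> 3 * 0"
      by (intro tendsto_mult tendsto_const tendsto_neg_powr filterlim_real_sequentially) simp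
    then show "(\<lambda>m. ereal (3 * real m powr (- 1 / 4))) \<longlonglongrightarrow> 0"
      by (simp add: zero_ereal_def)
  qed simp
qed

end
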